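(* Let $G$ be a $6$-regular $(4,1)$-graph and let $A$ be a shore of a nontrivial $6$-edge-cut of $G$. Then the induced subgraph $G[A]$ is not bipartite.
   Context: All graphs are finite and simple. A $(4,1)$-graph is a graph $G$ with $\chi(G)=4$, $\chi(G-v)=3$ for every vertex $v$, and $\chi(G-e)=4$ for every edge $e$. For a partition $V(G)=A\sqcup B$ with $A,B$ nonempty, the edge cut is the set $E(A,B)$ of edges with one end in $A$ and one in $B$; it is a $6$-edge-cut if $|E(A,B)|=6$, and $A$ and $B$ are its shores. A $6$-edge-cut is trivial if it is the set of all edges incident to a single vertex, and nontrivial otherwise (so both shores have at least two vertices). *)

theory Defs
  imports Main
begin

record 'a ugraph =
  verts :: "'a set"
  edges :: "'a set set"

definition simple_graph :: "'a ugraph \<Rightarrow> bool" where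
  "simple_graph G \<longleftrightarrow>
     finite (verts G) \<and> (\<forall>e\<in>edges G. e \<subseteq> verts G \<and> card e = 2)"

definition induced_subgraph :: "'a ugraph \<Rightarrow> 'a set \<Rightarrow> 'a ugraph" where
  "induced_subgraph G A = \<lparr>verts = verts G \<inter> A, edges = {e \<in> edges G. e \<subseteq> A}\<rparr>"

definition delete_vertex :: "'a ugraph \<Rightarrow> 'a \<Rightarrow> 'a ugraph" where
  "delete_vertex G v = induced_subgraph G (verts G - {v})"

definition delete_edge :: "'a ugraph \<Rightarrow> 'a set \<Rightarrow> 'a ugraph" where
  "delete_edge G e = \<lparr>verts = verts G, edges = edges G - {e}\<rparr>"

definition incident_edges :: "'a ugraph \<Rightarrow> 'a \<Rightarrow> 'a set set" where
  "incident_edges G v = {e \<in> edges G. v \<in> e}"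

definition degree :: "'a ugraph \<Rightarrow> 'a \<Rightarrow> nat" where
  "degree G v = card (incident_edges G v)"

definition regular :: "'a ugraph \<Rightarrow> nat \<Rightarrow> bool" where
  "regular G d \<longleftrightarrow> (\<forall>v\<in>verts G. degree G v = d)"

definition proper_coloring :: "'a ugraph \<Rightarrow> nat \<Rightarrow> ('a \<Rightarrow> nat) \<Rightarrow> bool" where
  "proper_coloring G k c \<longleftrightarrow>
     (\<forall>v\<in>verts G. c v < k) \<and> (\<forall>u v. {u, v} \<in> edges G \<longrightarrow> c u \<noteq> c v)"

(* Meaningful only for simple graphs, where some k always qualifies. *)
definition chromatic_number :: "'a ugraph \<Rightarrow> nat" where
  "chromatic_number G = (LEAST k. \<exists>c. proper_coloring G k c)"

definition four_one_graph :: "'a ugraph \<Rightarrow> bool" where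
  "four_one_graph G \<longleftrightarrow>
     simple_graph G \<and>
     chromatic_number G = 4 \<and>
     (\<forall>v\<in>verts G. chromatic_number (delete_vertex G v) = 3) \<and>
     (\<forall>e\<in>edges G. chromatic_number (delete_edge G e) = 4)"

(* The parts are allowed to be empty, so edgeless graphs are bipartite. *)
definition bipartite :: "'a ugraph \<Rightarrow> bool" where
  "bipartite G \<longleftrightarrow>
     (\<exists>X Y. X \<union> Y = verts G \<and> X \<inter> Y = {} \<and>
        (\<forall>e\<in>edges G. \<exists>x\<in>X. \<exists>y\<in>Y. e = {x, y}))"

definition shores :: "'a ugraph \<Rightarrow> 'a set \<Rightarrow> 'a set \<Rightarrow> bool" where
  "shores G A B \<longleftrightarrow> A \<noteq> {} \<and> B \<noteq> {} \<and> A \<union> B = verts G \<and> A \<inter> B = {}"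

definition edge_cut :: "'a ugraph \<Rightarrow> 'a set \<Rightarrow> 'a set \<Rightarrow> 'a set set" where
  "edge_cut G A B = {e \<in> edges G. \<exists>a\<in>A. \<exists>b\<in>B. e = {a, b}}"

definition trivial_cut :: "'a ugraph \<Rightarrow> 'a set set \<Rightarrow> bool" where
  "trivial_cut G F \<longleftrightarrow> (\<exists>v\<in>verts G. F = incident_edges G v)"

definition nontrivial_six_edge_cut :: "'a ugraph \<Rightarrow> 'a set \<Rightarrow> 'a set \<Rightarrow> bool" where
  "nontrivial_six_edge_cut G A B \<longleftrightarrow>
     shores G A B \<and> card (edge_cut G A B) = 6 \<and> \<not> trivial_cut G (edge_cut G A B)"

end

theory Submission
  imports Defs
begin

text \<open>
  Two 3-colourings \<open>f\<close> of \<open>G[A]\<close> and \<open>c\<close> of \<open>G[B]\<close> can be glued in six ways, one for each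
  permutation of the colours on \<open>A\<close>.  Every cut edge becomes monochromatic under exactly two of the
  six permutations, so with six cut edges the gluings have twelve monochromatic edges in total, two
  on average.  None has fewer than two, since otherwise deleting one edge would leave a 3-colourable
  graph.  Hence \<^emph>\<open>every\<close> gluing has exactly two monochromatic edges
  (\<open>transversal_eq_two\<close>), whatever \<open>f\<close> and \<open>c\<close> are.

  Suppose that \<open>G[A]\<close> is bipartite with parts \<open>X\<close> and \<open>Y\<close>, and let \<open>a \<in> A\<close> be an end of a cut
  edge, say \<open>a \<in> X\<close>.  The third colour is free on \<open>A\<close>, so both \<open>X, Y\<close> and \<open>X - {a}, Y, {a}\<close> are
  colour classes of a 3-colouring of \<open>G[A]\<close>.  Comparing the two systems of equations shows that \<open>a\<close>
  has equally many neighbours in each colour class of \<open>B\<close>, hence at least one in each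
  (\<open>sees_every_colour\<close>).  So no 3-colouring of \<open>G[B]\<close> extends to \<open>a\<close>.

  The cut is nontrivial and \<open>G\<close> is 6-regular, so the cut edges have at least two ends \<open>a \<noteq> v\<close> in
  \<open>A\<close>.  But \<open>G - v\<close> is 3-colourable and contains \<open>B\<close> and \<open>a\<close>, a contradiction.
\<close>

section \<open>Colourings and crossing edges\<close>

lemma ex_proper_coloring_chromatic_number:
  assumes "simple_graph G"
  shows "\<exists>c. proper_coloring G (chromatic_number G) c"
proof -
  have fin: "finite (verts G)"
    using assms by (simp add: simple_graph_def)
  obtain h :: "'a \<Rightarrow> nat" where h: "inj_on h (verts G)" and im: "h ` verts G = {..<card (verts G)}"
    using ex_bij_betw_finite_nat[OF fin] by (auto simp: bij_betw_def atLeast0LessThan)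
  have "h u \<noteq> h v" if "{u, v} \<in> edges G" for u v
  proof -
    have "{u, v} \<subseteq> verts G" "card {u, v} = 2"
      using assms that by (auto simp: simple_graph_def)
    then have "u \<in> verts G" "v \<in> verts G" "u \<noteq> v"
      by auto
    then show ?thesis
      using h by (auto simp: inj_on_def)
  qed
  then have "proper_coloring G (card (verts G)) h"
    using im by (auto simp: proper_coloring_def)
  then have "\<exists>k c. proper_coloring G k c"
    by blast
  then show ?thesis
    unfolding chromatic_number_def by (rule LeastI_ex)
qed

lemma chromatic_number_le: "proper_coloring G k c \<Longrightarrow> chromatic_number G \<le> k"
  unfolding chromatic_number_def by (blast intro: Least_le)

definition independent :: "'a ugraph \<Rightarrow> 'a set \<Rightarrow> bool" where
  "independent G S \<longleftrightarrow> (\<forall>u\<in>S. \<forall>v\<in>S. {u, v} \<notin> edges G)"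

text \<open>
  Edges between \<open>S\<close> and \<open>T\<close> are kept as ordered pairs, so that splitting \<open>S\<close> or \<open>T\<close> splits the
  set of pairs.
\<close>

definition crossing :: "'a ugraph \<Rightarrow> 'a set \<Rightarrow> 'a set \<Rightarrow> ('a \<times> 'a) set" where
  "crossing G S T = {(s, t). s \<in> S \<and> t \<in> T \<and> {s, t} \<in> edges G}"

lemma crossing_empty_left [simp]: "crossing G {} T = {}"
  by (simp add: crossing_def)

lemma finite_crossing:
  assumes "simple_graph G"
  shows "finite (crossing G S T)"
proof (rule finite_subset)
  show "crossing G S T \<subseteq> verts G \<times> verts G"
    using assms unfolding crossing_def simple_graph_def by blast
  show "finite (verts G \<times> verts G)"
    using assms by (simp add: simple_graph_def)
qed

lemma card_crossing_Un_left:
  assumes "simple_graph G" "S \<inter> S' = {}"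
  shows "card (crossing G (S \<union> S') T) = card (crossing G S T) + card (crossing G S' T)"
proof -
  have "crossing G (S \<union> S') T = crossing G S T \<union> crossing G S' T"
    by (auto simp: crossing_def)
  moreover have "crossing G S T \<inter> crossing G S' T = {}"
    using assms(2) by (auto simp: crossing_def)
  ultimately show ?thesis
    using finite_crossing[OF assms(1)] by (simp add: card_Un_disjoint)
qed

lemma card_crossing_Un_right:
  assumes "simple_graph G" "T \<inter> T' = {}"
  shows "card (crossing G S (T \<union> T')) = card (crossing G S T) + card (crossing G S T')"
proof -
  have "crossing G S (T \<union> T') = crossing G S T \<union> crossing G S T'"
    by (auto simp: crossing_def)
  moreover have "crossing G S T \<inter> crossing G S T' = {}"
    using assms(2) by (auto simp: crossing_def)
  ultimately show ?thesis
    using finite_crossing[OF assms(1)] by (simp add: card_Un_disjoint)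
qed

lemma card_crossing_eq_card_edge_cut:
  assumes "A \<inter> B = {}"
  shows "card (crossing G A B) = card (edge_cut G A B)"
proof -
  have "inj_on (\<lambda>(a, b). {a, b}) (crossing G A B)"
    using assms by (auto simp: inj_on_def crossing_def doubleton_eq_iff)
  moreover have "(\<lambda>(a, b). {a, b}) ` crossing G A B = edge_cut G A B"
    by (force simp: crossing_def edge_cut_def)
  ultimately show ?thesis
    using card_image by fastforce
qed

lemma permutation_cases:
  assumes "{i, j, k} = {0, 1, 2::nat}"
  shows "(i, j, k) \<in> {(0, 1, 2), (0, 2, 1), (1, 0, 2), (1, 2, 0), (2, 0, 1), (2, 1, 0)}"
proof -
  have "i \<in> {0, 1, 2}" "j \<in> {0, 1, 2}" "k \<in> {0, 1, 2}"
    unfolding assms[symmetric] by simp_all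
  moreover have "i \<noteq> j \<and> i \<noteq> k \<and> j \<noteq> k"
  proof -
    have "card {i, j, k} = 3"
      unfolding assms by simp
    then show ?thesis
      by (auto simp: card_insert_if split: if_splits)
  qed
  ultimately show ?thesis
    unfolding insert_iff empty_iff prod.inject by (elim disjE; simp)
qed

section \<open>Gluing colourings across a six-edge cut\<close>

text \<open>
  The situation of the gluing argument.  Only the colouring \<open>c\<close> of the shore \<open>B\<close> is fixed: the
  colouring of \<open>A\<close> varies, and is given below by its colour classes.
\<close>

locale coloured_six_cut =
  fixes G :: "'a ugraph" and A B :: "'a set" and c :: "'a \<Rightarrow> nat"
  assumes simple: "simple_graph G"
    and shores: "shores G A B"
    and card_cut: "card (crossing G A B) = 6"
    and no_critical_edge: "\<And>e h. e \<in> edges G \<Longrightarrow> \<not> proper_coloring (delete_edge G e) 3 h"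
    and colour_less: "\<And>b. b \<in> B \<Longrightarrow> c b < 3"
    and colour_proper: "\<And>u v. u \<in> B \<Longrightarrow> v \<in> B \<Longrightarrow> {u, v} \<in> edges G \<Longrightarrow> c u \<noteq> c v"
begin

definition colour_class :: "nat \<Rightarrow> 'a set" where
  "colour_class i = {b \<in> B. c b = i}"

abbreviation count :: "'a set \<Rightarrow> nat \<Rightarrow> nat" where
  "count S i \<equiv> card (crossing G S (colour_class i))"

lemma card_crossing_B: "card (crossing G S B) = count S 0 + count S 1 + count S 2"
proof -
  have "B = (colour_class 0 \<union> colour_class 1) \<union> colour_class 2"
    using colour_less by (force simp: colour_class_def)
  moreover have "(colour_class 0 \<union> colour_class 1) \<inter> colour_class 2 = {}"
    "colour_class 0 \<inter> colour_class 1 = {}"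
    by (auto simp: colour_class_def)
  ultimately show ?thesis
    by (metis card_crossing_Un_right[OF simple])
qed

text \<open>
  Giving \<open>P\<close>, \<open>Q\<close>, \<open>R\<close> the colours \<open>i\<close>, \<open>j\<close>, \<open>k\<close> and keeping \<open>c\<close> on \<open>B\<close> glues two colourings.
  The sum counts its monochromatic edges; if there is at most one, deleting it leaves a properly
  3-coloured graph.
\<close>

lemma transversal_ge_two:
  assumes parts: "P \<union> Q \<union> R = A" "P \<inter> Q = {}" "P \<inter> R = {}" "Q \<inter> R = {}"
    and indep: "independent G P" "independent G Q" "independent G R"
    and perm: "{i, j, k} = {0, 1, 2::nat}"
  shows "2 \<le> count P i + count Q j + count R k"
proof (rule ccontr)
  assume less: "\<not> 2 \<le> count P i + count Q j + count R k"
  have disj: "A \<inter> B = {}" and verts: "A \<union> B = verts G"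
    using shores by (auto simp: shores_def)
  have colours: "i < 3" "j < 3" "k < 3" and distinct: "i \<noteq> j" "i \<noteq> k" "j \<noteq> k"
    using permutation_cases[OF perm] by auto
  define h where "h v = (if v \<in> P then i else if v \<in> Q then j else if v \<in> R then k else c v)" for v
  define D where "D = crossing G P (colour_class i) \<union> crossing G Q (colour_class j)
    \<union> crossing G R (colour_class k)"
  have "finite D"
    using finite_crossing[OF simple] by (simp add: D_def)
  moreover have "card D \<le> 1"
    using less card_Un_le[of "crossing G P (colour_class i) \<union> crossing G Q (colour_class j)"
        "crossing G R (colour_class k)"]
      card_Un_le[of "crossing G P (colour_class i)" "crossing G Q (colour_class j)"]
    by (simp add: D_def)
  moreover have "D \<subseteq> crossing G A B"
    using parts(1) by (auto simp: D_def crossing_def colour_class_def)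
  moreover have "crossing G A B \<noteq> {}"
    using card_cut by auto
  ultimately have "\<exists>p \<in> crossing G A B. D \<subseteq> {p}"
  proof (cases "D = {}")
    case False
    then obtain p where "p \<in> D"
      by blast
    then have "D \<subseteq> {p}"
      using \<open>finite D\<close> \<open>card D \<le> 1\<close> card_le_Suc0_iff_eq[of D] by auto
    then show ?thesis
      using \<open>p \<in> D\<close> \<open>D \<subseteq> crossing G A B\<close> by blast
  qed blast
  then obtain a b where ab: "(a, b) \<in> crossing G A B" "D \<subseteq> {(a, b)}"
    by auto
  have cross: "{u, v} = {a, b}" if "u \<in> A" "v \<in> B" "{u, v} \<in> edges G" "h u = h v" for u v
  proof -
    have "h v = c v"
      using that(2) disj parts(1) by (auto simp: h_def)
    then have "(u, v) \<in> D"
      using that parts by (auto simp: D_def h_def crossing_def colour_class_def split: if_splits)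
    then show ?thesis
      using ab(2) by auto
  qed
  have inner: "h u \<noteq> h v" if "u \<in> A" "v \<in> A" "{u, v} \<in> edges G" for u v
    using that parts indep distinct by (auto simp: h_def independent_def)
  have "h u \<noteq> h v" if "{u, v} \<in> edges (delete_edge G {a, b})" for u v
  proof -
    have uv: "{u, v} \<in> edges G" "{u, v} \<noteq> {a, b}"
      using that by (auto simp: delete_edge_def)
    then have "u \<in> A \<union> B" "v \<in> A \<union> B"
      using simple verts by (auto simp: simple_graph_def)
    moreover have "h u \<noteq> h v" if "u \<in> B" "v \<in> B"
    proof -
      have "h u = c u" "h v = c v"
        using that disj parts(1) by (auto simp: h_def)
      then show ?thesis
        using colour_proper that uv(1) by metis
    qed
    moreover have "h u \<noteq> h v" if "u \<in> A" "v \<in> B"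
      using cross[OF that uv(1)] uv(2) by blast
    moreover have "h u \<noteq> h v" if "u \<in> B" "v \<in> A"
      using cross[OF that(2,1)] uv by (auto simp: insert_commute)
    ultimately show ?thesis
      using inner uv(1) by blast
  qed
  moreover have "h v < 3" if "v \<in> verts G" for v
    using that colours colour_less verts parts(1) by (auto simp: h_def)
  ultimately have "proper_coloring (delete_edge G {a, b}) 3 h"
    by (auto simp: proper_coloring_def delete_edge_def)
  moreover have "{a, b} \<in> edges G"
    using ab(1) by (simp add: crossing_def)
  ultimately show False
    using no_critical_edge by blast
qed

text \<open>
  The six sums of this form together count each of the six cut edges twice, so the bound 2 for each
  of them is attained.
\<close>

lemma transversal_eq_two:
  assumes parts: "P \<union> Q \<union> R = A" "P \<inter> Q = {}" "P \<inter> R = {}" "Q \<inter> R = {}"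
    and indep: "independent G P" "independent G Q" "independent G R"
    and perm: "{i, j, k} = {0, 1, 2::nat}"
  shows "count P i + count Q j + count R k = 2"
proof -
  have "(P \<union> Q) \<inter> R = {}"
    using parts by blast
  then have "card (crossing G (P \<union> Q \<union> R) B)
      = card (crossing G P B) + card (crossing G Q B) + card (crossing G R B)"
    using parts(2) by (simp only: card_crossing_Un_left[OF simple])
  then have total: "count P 0 + count P 1 + count P 2 + (count Q 0 + count Q 1 + count Q 2)
      + (count R 0 + count R 1 + count R 2) = 6"
    using card_cut parts(1) by (simp only: card_crossing_B)
  have ge: "2 \<le> count P 0 + count Q 1 + count R 2" "2 \<le> count P 0 + count Q 2 + count R 1"
    "2 \<le> count P 1 + count Q 0 + count R 2" "2 \<le> count P 1 + count Q 2 + count R 0"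
    "2 \<le> count P 2 + count Q 0 + count R 1" "2 \<le> count P 2 + count Q 1 + count R 0"
    by (rule transversal_ge_two[OF parts indep], blast)+
  from permutation_cases[OF perm] show ?thesis
    unfolding insert_iff empty_iff prod.inject
    by (elim disjE conjE FalseE; hypsubst) (use ge total in linarith)+
qed

text \<open>
  With an empty third class, the equations make the counts from \<open>X\<close> and from \<open>Y\<close> independent of the
  colour.  Moving \<open>a\<close> into a class of its own then makes the counts from \<open>a\<close> constant as well.
\<close>

lemma sees_every_colour:
  assumes parts: "X \<union> Y = A" "X \<inter> Y = {}" and indep: "independent G X" "independent G Y"
    and a: "a \<in> X" and cut: "crossing G {a} B \<noteq> {}" and j: "j < 3"
  shows "\<exists>b\<in>B. {a, b} \<in> edges G \<and> c b = j"
proof -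
  have "count X i + count Y j + count {} k = 2" if "{i, j, k} = {0, 1, 2}" for i j k
    using parts indep that by (intro transversal_eq_two) (auto simp: independent_def)
  then have two: "count X i + count Y j = 2" if "{i, j, k} = {0, 1, 2}" for i j k
    using that by (metis add_0_right card.empty crossing_empty_left)
  \<comment> \<open>The same with \<open>a\<close> recoloured in the third colour, which was not used on \<open>A\<close>.\<close>
  have three: "count (X - {a}) i + count Y j + count {a} k = 2" if "{i, j, k} = {0, 1, 2}" for i j k
  proof (rule transversal_eq_two)
    have "a \<notin> Y"
      using a parts(2) by blast
    then show "Y \<inter> {a} = {}"
      by blast
    show "independent G {a}"
      using a indep(1) unfolding independent_def by blast
  qed (use parts indep a that in \<open>auto simp: independent_def\<close>)
  have split: "count X i = count (X - {a}) i + count {a} i" for i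
    using card_crossing_Un_left[OF simple, of "X - {a}" "{a}"] a by (simp add: insert_absorb)
  have eq: "count {a} i = count {a} k" if "{i, j, k} = {0, 1, 2}" for i j k
    using two[OF that] three[OF that] split[of i] by linarith
  have "count {a} 0 = count {a} 1" "count {a} 0 = count {a} 2"
    by (rule eq[of 0 2 1], blast) (rule eq[of 0 1 2], blast)
  moreover have "0 < card (crossing G {a} B)"
    using cut finite_crossing[OF simple] by (simp add: card_gt_0_iff)
  moreover have "j = 0 \<or> j = 1 \<or> j = 2"
    using j by auto
  ultimately have "0 < count {a} j"
    unfolding card_crossing_B by auto
  then have "crossing G {a} (colour_class j) \<noteq> {}"
    by (metis card.empty less_irrefl)
  then show ?thesis
    by (auto simp: crossing_def colour_class_def)
qed

end

section \<open>Bipartite shores\<close>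

text \<open>
  If a single vertex \<open>v\<close> of \<open>A\<close> met all cut edges, these would be six of the six edges at \<open>v\<close>, and
  the cut would be trivial.
\<close>

lemma nontrivial_cut_two_ends:
  assumes simple: "simple_graph G" and reg: "regular G 6"
    and cut: "nontrivial_six_edge_cut G A B" and v: "v \<in> A"
  shows "\<exists>a\<in>A. a \<noteq> v \<and> crossing G {a} B \<noteq> {}"
proof (rule ccontr)
  assume none: "\<not> ?thesis"
  have vG: "v \<in> verts G"
    using cut v by (auto simp: nontrivial_six_edge_cut_def shores_def)
  have deg: "card (incident_edges G v) = 6"
    using reg vG by (simp add: regular_def degree_def)
  have "edge_cut G A B \<subseteq> incident_edges G v"
    using none by (fastforce simp: edge_cut_def incident_edges_def crossing_def)
  moreover have "finite (incident_edges G v)"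
    by (rule card_ge_0_finite) (simp add: deg)
  ultimately have "edge_cut G A B = incident_edges G v"
    using cut deg by (simp add: card_subset_eq nontrivial_six_edge_cut_def)
  then show False
    using cut vG by (auto simp: nontrivial_six_edge_cut_def trivial_cut_def)
qed

lemma bipartite_inducedE:
  assumes "bipartite (induced_subgraph G A)" "A \<subseteq> verts G" "a \<in> A"
  obtains X Y where "X \<union> Y = A" "X \<inter> Y = {}" "independent G X" "independent G Y" "a \<in> X"
proof -
  obtain X Y where XY: "X \<union> Y = A" "X \<inter> Y = {}"
    and e: "\<And>e. e \<in> edges G \<Longrightarrow> e \<subseteq> A \<Longrightarrow> \<exists>x\<in>X. \<exists>y\<in>Y. e = {x, y}"
    using assms(1,2) by (auto simp: bipartite_def induced_subgraph_def Int_absorb1)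
  have indX: "independent G X"
    unfolding independent_def
  proof (intro ballI notI)
    fix u v assume "u \<in> X" "v \<in> X" "{u, v} \<in> edges G"
    then show False
      using e[of "{u, v}"] XY by (auto simp: doubleton_eq_iff)
  qed
  have indY: "independent G Y"
    unfolding independent_def
  proof (intro ballI notI)
    fix u v assume "u \<in> Y" "v \<in> Y" "{u, v} \<in> edges G"
    then show False
      using e[of "{u, v}"] XY by (auto simp: doubleton_eq_iff)
  qed
  show thesis
  proof (cases "a \<in> X")
    case True
    then show ?thesis
      using that XY indX indY by blast
  next
    case False
    then show ?thesis
      using that[of Y X] XY indX indY assms(3) by blast
  qed
qed

theorem theorem6p4:
  fixes G :: "'a ugraph" and A B :: "'a set"
  assumes "four_one_graph G"
    and "regular G 6"
    and "nontrivial_six_edge_cut G A B"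
  shows "\<not> bipartite (induced_subgraph G A)"
proof
  assume bip: "bipartite (induced_subgraph G A)"
  have simple: "simple_graph G"
    and vertex_critical: "\<And>v. v \<in> verts G \<Longrightarrow> chromatic_number (delete_vertex G v) = 3"
    and no_critical_edge: "\<And>e. e \<in> edges G \<Longrightarrow> chromatic_number (delete_edge G e) = 4"
    using assms(1) by (auto simp: four_one_graph_def)
  have shores: "shores G A B" and card_cut: "card (edge_cut G A B) = 6"
    using assms(3) by (auto simp: nontrivial_six_edge_cut_def)
  then have disj: "A \<inter> B = {}" and verts: "A \<union> B = verts G"
    by (auto simp: shores_def)
  obtain v where v: "v \<in> A"
    using shores by (auto simp: shores_def)
  obtain a where a: "a \<in> A" "a \<noteq> v" "crossing G {a} B \<noteq> {}"
    using nontrivial_cut_two_ends[OF simple assms(2,3) v] by blast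
  have "simple_graph (delete_vertex G v)"
    using simple by (auto simp: simple_graph_def delete_vertex_def induced_subgraph_def)
  moreover have "chromatic_number (delete_vertex G v) = 3"
    using vertex_critical v verts by blast
  ultimately obtain c where "proper_coloring (delete_vertex G v) 3 c"
    using ex_proper_coloring_chromatic_number by metis
  then have less: "\<And>u. u \<in> verts G \<Longrightarrow> u \<noteq> v \<Longrightarrow> c u < 3"
    and proper: "\<And>u w. {u, w} \<in> edges G \<Longrightarrow> u \<noteq> v \<Longrightarrow> w \<noteq> v \<Longrightarrow> c u \<noteq> c w"
    using simple
    by (auto simp: proper_coloring_def delete_vertex_def induced_subgraph_def simple_graph_def)
  have notB: "u \<noteq> v" if "u \<in> B" for u
    using that v disj by blast
  interpret coloured_six_cut G A B c
  proof
    show "card (crossing G A B) = 6"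
      using card_crossing_eq_card_edge_cut[OF disj] card_cut by simp
    show "\<not> proper_coloring (delete_edge G e) 3 h" if "e \<in> edges G" for e h
      using no_critical_edge[OF that] chromatic_number_le[of "delete_edge G e" 3 h] by auto
    show "c b < 3" if "b \<in> B" for b
      using that less notB verts by blast
    show "c u \<noteq> c w" if "u \<in> B" "w \<in> B" "{u, w} \<in> edges G" for u w
      using that proper notB by blast
  qed (use simple shores in auto)
  obtain X Y where "X \<union> Y = A" "X \<inter> Y = {}" "independent G X" "independent G Y" "a \<in> X"
    using bipartite_inducedE[OF bip _ a(1)] verts by blast
  moreover have "c a < 3"
    using less a verts by blast
  ultimately obtain b where "b \<in> B" "{a, b} \<in> edges G" "c b = c a"
    using sees_every_colour a(3) by metis
  then show False
    using proper a(2) notB by metis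
qed

end
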